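(* Every connected $3$-regular permutation graph is a blow-up of a path.
   Context: All graphs are finite and simple. A graph $G$ on $n$ vertices is a permutation graph if there is a labeling $v_1, \ldots, v_n$ of its vertices and a permutation $\pi$ of $\{1,\ldots,n\}$ such that for $i<j$, $v_i$ and $v_j$ are adjacent iff $\pi(i) > \pi(j)$. For a graph $G$ with vertices $v_1,\ldots,v_n$ and graphs $H_1,\ldots,H_n$, the composition $G[H_1,\ldots,H_n]$ has vertex set the disjoint union of the $V(H_i)$, and $uv$ is an edge iff either $uv \in E(H_i)$ for some $i$, or $u \in V(H_i)$, $v \in V(H_j)$ for distinct $i,j$ with $v_iv_j \in E(G)$. If every $H_i$ is a complete graph or an edgeless graph on at least one vertex, this is a blow-up of $G$; a blow-up of a path is a blow-up of some path $P_m$, $m\ge1$. *)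

theory Defs
  imports "Graph_Theory.Graph_Theory" "HOL-Combinatorics.Permutations"
begin

text \<open>
  A finite simple graph is a \<^locale>\<open>pair_graph\<close>: each edge \<open>uv\<close> is represented by
  the two arcs \<open>(u, v)\<close> and \<open>(v, u)\<close>, so the degree of a vertex is its out-degree.
\<close>

definition regular_graph :: "nat \<Rightarrow> 'a pair_pre_digraph \<Rightarrow> bool" where
  "regular_graph k G \<longleftrightarrow> (\<forall>v \<in> pverts G. out_degree G v = k)"

definition permutation_graph :: "'a pair_pre_digraph \<Rightarrow> bool" where
  "permutation_graph G \<longleftrightarrow>
     (let n = card (pverts G) in
      \<exists>v \<pi>. bij_betw v {1..n} (pverts G) \<and> \<pi> permutes {1..n} \<and>
        (\<forall>i \<in> {1..n}. \<forall>j \<in> {1..n}. i < j \<longrightarrow> ((v i, v j) \<in> parcs G \<longleftrightarrow> \<pi> i > \<pi> j)))"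

text \<open>
  In the composition \<open>G[H\<^sub>1, \<dots>, H\<^sub>n]\<close> the graphs are indexed by the vertices of \<open>G\<close>
  themselves, and tagging with the index makes the union of the vertex sets disjoint.
\<close>

definition graph_composition ::
    "'a pair_pre_digraph \<Rightarrow> ('a \<Rightarrow> 'b pair_pre_digraph) \<Rightarrow> ('a \<times> 'b) pair_pre_digraph" where
  "graph_composition G H =
     (let V = (SIGMA i : pverts G. pverts (H i)) in
      \<lparr> pverts = V,
        parcs = {((i, u), (j, v)) | i u j v. (i, u) \<in> V \<and> (j, v) \<in> V \<and>
                   (i = j \<and> (u, v) \<in> parcs (H i) \<or> i \<noteq> j \<and> (i, j) \<in> parcs G)} \<rparr>)"

definition complete_graph :: "'a pair_pre_digraph \<Rightarrow> bool" where
  "complete_graph G \<longleftrightarrow> (\<exists>n. K\<^bsub>n\<^esub> (with_proj G))"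

definition edgeless_graph :: "'a pair_pre_digraph \<Rightarrow> bool" where
  "edgeless_graph G \<longleftrightarrow> pair_graph G \<and> parcs G = {}"

text \<open>
  Being a blow-up is understood up to isomorphism. Since the graphs \<open>H i\<close> are finite,
  taking their vertices to be natural numbers is no restriction.
\<close>

definition blow_up_of :: "'a pair_pre_digraph \<Rightarrow> 'b pair_pre_digraph \<Rightarrow> bool" where
  "blow_up_of B G \<longleftrightarrow>
     (\<exists>H :: 'b \<Rightarrow> nat pair_pre_digraph.
        (\<forall>i \<in> pverts G. pverts (H i) \<noteq> {} \<and> (complete_graph (H i) \<or> edgeless_graph (H i))) \<and>
        digraph_iso (with_proj B) (with_proj (graph_composition G H)))"

definition path_graph :: "nat \<Rightarrow> nat pair_pre_digraph" where
  "path_graph m =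
     \<lparr> pverts = {1..m},
       parcs = {(i, j). i \<in> {1..m} \<and> j \<in> {1..m} \<and> (j = i + 1 \<or> i = j + 1)} \<rparr>"

definition blow_up_of_path :: "'a pair_pre_digraph \<Rightarrow> bool" where
  "blow_up_of_path B \<longleftrightarrow> (\<exists>m \<ge> 1. blow_up_of B (path_graph m))"

lemma pverts_graph_composition [simp]:
  "pverts (graph_composition G H) = (SIGMA i : pverts G. pverts (H i))"
  by (simp add: graph_composition_def Let_def)

lemma in_parcs_graph_composition [simp]:
  "((i, u), (j, v)) \<in> parcs (graph_composition G H) \<longleftrightarrow>
     i \<in> pverts G \<and> u \<in> pverts (H i) \<and> j \<in> pverts G \<and> v \<in> pverts (H j) \<and>
     (i = j \<and> (u, v) \<in> parcs (H i) \<or> i \<noteq> j \<and> (i, j) \<in> parcs G)"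
  by (simp add: graph_composition_def Let_def)

lemma pair_graphI:
  assumes "finite (pverts G)"
    and wf: "\<And>u v. (u, v) \<in> parcs G \<Longrightarrow> u \<in> pverts G \<and> v \<in> pverts G \<and> u \<noteq> v \<and> (v, u) \<in> parcs G"
  shows "pair_graph G"
proof
  show "finite (parcs G)"
    by (rule finite_subset[of _ "pverts G \<times> pverts G"]) (use assms in auto)
  show "symmetric (with_proj G)"
    unfolding symmetric_def with_proj_simps by (rule symI) (use wf in blast)
  show "fst e \<in> pverts G" "snd e \<in> pverts G" "fst e \<noteq> snd e" if "e \<in> parcs G" for e
    using wf[of "fst e" "snd e"] that by simp_all
qed (rule assms(1))

lemma pair_graph_path_graph: "pair_graph (path_graph m)"
  by (rule pair_graphI) (simp_all add: path_graph_def, linarith)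

lemma pair_graph_graph_composition:
  assumes G: "pair_graph G" and H: "\<And>i. i \<in> pverts G \<Longrightarrow> pair_graph (H i)"
  shows "pair_graph (graph_composition G H)"
proof (rule pair_graphI)
  have "finite (pverts G)"
    using G by (simp add: pair_graph_def pair_digraph_def pair_fin_digraph.pair_finite_verts)
  moreover have "finite (pverts (H i))" if "i \<in> pverts G" for i
    using H[OF that] by (simp add: pair_graph_def pair_digraph_def pair_fin_digraph.pair_finite_verts)
  ultimately show "finite (pverts (graph_composition G H))"
    by simp
next
  have edge: "u \<noteq> v \<and> (v, u) \<in> parcs K" if K: "pair_graph K" and e: "(u, v) \<in> parcs K"
    for K :: "'c pair_pre_digraph" and u v
  proof -
    have "symmetric (with_proj K)"
      using K by (simp add: pair_graph_def pair_pseudo_graph_def pair_sym_digraph.pair_sym_arcs)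
    moreover have "pair_loopfree_digraph K"
      using K by (simp add: pair_graph_def pair_digraph_def)
    ultimately show ?thesis
      using e pair_loopfree_digraph.pair_no_loops[of K "(u, v)"]
      by (auto simp: symmetric_def dest: symD)
  qed
  have symG: "(j, i) \<in> parcs G" if "(i, j) \<in> parcs G" for i j
    using G that pair_sym_digraph.pair_sym_arcs[of G]
    by (auto simp: pair_graph_def pair_pseudo_graph_def symmetric_def dest: symD)
  fix x y assume xy: "(x, y) \<in> parcs (graph_composition G H)"
  obtain i u j v where [simp]: "x = (i, u)" "y = (j, v)" by (cases x, cases y)
  from xy show "x \<in> pverts (graph_composition G H) \<and> y \<in> pverts (graph_composition G H) \<and> x \<noteq> y
      \<and> (y, x) \<in> parcs (graph_composition G H)"
    using edge[OF H] symG by auto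
qed

end

theory Submission
  imports Defs
begin

text \<open>
  The two linear orders of a permutation model orient the edges transitively (relation \<open>T\<close>) and
  the non-edges transitively (relation \<open>P\<close>). The first vertex \<open>x\<close> of one order and the first
  vertex \<open>y\<close> of the other are adjacent, and the number of their common neighbours determines one
  end of the graph: it is \<open>K\<^sub>4\<close>, or \<open>K\<^sub>3\<^sub>,\<^sub>3\<close>, or it starts with layers of sizes 2, 2, 1 with a
  single edge leaving them. From such an edge on, the layers are peeled off one gadget at a time:
  transitivity of \<open>T\<close> and \<open>P\<close> forces two vertices that have to be twins to have the same third
  neighbour, so that the peeled part again ends in a single vertex with a single leaving edge
  or exhausts the graph.
\<close>

section \<open>Layerings along a path\<close>

definition homogeneous :: "('a \<Rightarrow> 'a \<Rightarrow> bool) \<Rightarrow> 'a set \<Rightarrow> bool" where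
  "homogeneous E A \<longleftrightarrow>
     (\<forall>a \<in> A. \<forall>b \<in> A. a \<noteq> b \<longrightarrow> E a b) \<or> (\<forall>a \<in> A. \<forall>b \<in> A. \<not> E a b)"

text \<open>The second argument is the union of the layers built so far, the third is the last of
  them. Layers are appended at that end only, so an unfinished layering needs no record of its
  earlier layers.\<close>

inductive path_layered :: "('a \<Rightarrow> 'a \<Rightarrow> bool) \<Rightarrow> 'a set \<Rightarrow> 'a set \<Rightarrow> bool"
  for E :: "'a \<Rightarrow> 'a \<Rightarrow> bool" where
  single: "homogeneous E A \<Longrightarrow> A \<noteq> {} \<Longrightarrow> path_layered E A A"
| extend: "path_layered E U L \<Longrightarrow> homogeneous E A \<Longrightarrow> A \<noteq> {} \<Longrightarrow> A \<inter> U = {} \<Longrightarrow>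
    (\<And>u a. u \<in> U \<Longrightarrow> a \<in> A \<Longrightarrow> E u a \<longleftrightarrow> u \<in> L) \<Longrightarrow> path_layered E (U \<union> A) A"

text \<open>\<open>f\<close> numbers the layers in the order of creation, and \<open>t i\<close>
  tells whether layer \<open>i\<close> is a clique. Old numbers are at most \<open>m\<close>, so a
  new layer can take \<open>m + 1\<close> without disturbing \<open>t\<close> on the others.\<close>

lemma path_layered_layer_function:
  assumes "path_layered E U L"
    and sym: "\<And>u v. E u v \<Longrightarrow> E v u" and irrefl: "\<And>u. \<not> E u u"
  shows "\<exists>f t (m::nat). m \<ge> 1 \<and> f ` U = {1..m} \<and> L = {u \<in> U. f u = m} \<and>
    (\<forall>u \<in> U. \<forall>v \<in> U. E u v \<longleftrightarrow> (u \<noteq> v \<and> f u = f v \<and> t (f u)) \<or> f u = f v + 1 \<or> f v = f u + 1)"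
  using assms(1)
proof (induction rule: path_layered.induct)
  case (single A)
  define t where "t = (\<lambda>_::nat. \<forall>a \<in> A. \<forall>b \<in> A. a \<noteq> b \<longrightarrow> E a b)"
  have "\<forall>u \<in> A. \<forall>v \<in> A. E u v \<longleftrightarrow> u \<noteq> v \<and> t 1"
    using single irrefl unfolding homogeneous_def t_def by blast
  with single(2) show ?case
    by (intro exI[of _ "\<lambda>_. 1"] exI[of _ t] exI[of _ 1]) (auto simp: image_constant_conv)
next
  case (extend U L A)
  then obtain f t m where m: "m \<ge> (1::nat)" and img: "f ` U = {1..m}" and L: "L = {u \<in> U. f u = m}"
    and E: "\<And>u v. u \<in> U \<Longrightarrow> v \<in> U \<Longrightarrow>
      E u v \<longleftrightarrow> (u \<noteq> v \<and> f u = f v \<and> t (f u)) \<or> f u = f v + 1 \<or> f v = f u + 1"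
    by blast
  define g where "g u = (if u \<in> A then m + 1 else f u)" for u
  define s where "s = t(m + 1 := \<forall>a \<in> A. \<forall>b \<in> A. a \<noteq> b \<longrightarrow> E a b)"
  have gU: "g u = f u" "f u \<le> m" "f u \<ge> 1" if "u \<in> U" for u
    using that img extend(4) by (auto simp: g_def)
  have gA: "g a = m + 1" if "a \<in> A" for a
    using that by (simp add: g_def)
  have "g ` U = f ` U" "g ` A = {m + 1}"
    using gU gA extend(3) by (auto simp: image_iff)
  hence "g ` (U \<union> A) = {1..m + 1}"
    using img by (auto simp: image_Un)
  moreover have "A = {u \<in> U \<union> A. g u = m + 1}"
    using gU gA by force
  moreover have "E u v \<longleftrightarrow> (u \<noteq> v \<and> g u = g v \<and> s (g u)) \<or> g u = g v + 1 \<or> g v = g u + 1"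
    if uv: "u \<in> U \<union> A" "v \<in> U \<union> A" for u v
  proof -
    consider "u \<in> U" "v \<in> U" | "u \<in> U" "v \<in> A" | "u \<in> A" "v \<in> U" | "u \<in> A" "v \<in> A"
      using uv by blast
    thus ?thesis
    proof cases
      case 1
      thus ?thesis using E[OF 1] gU[of u] gU[of v] by (auto simp: s_def)
    next
      case 2
      thus ?thesis using extend(5)[OF 2] gU[of u] gA[of v] L by auto
    next
      case 3
      have "E u v \<longleftrightarrow> v \<in> L" using extend(5)[OF 3(2,1)] sym by blast
      thus ?thesis using 3 gU[of v] gA[of u] L by auto
    next
      case 4
      have "E u v \<longleftrightarrow> u \<noteq> v \<and> s (m + 1)"
        using 4 extend(2) irrefl unfolding homogeneous_def s_def fun_upd_same by blast
      thus ?thesis using gA[OF 4(1)] gA[OF 4(2)] by simp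
    qed
  qed
  ultimately show ?case
    by (intro exI[of _ g] exI[of _ s] exI[of _ "m + 1"]) auto
qed

section \<open>From layer numbers to a blow-up\<close>

lemma blow_up_of_pathI:
  fixes f :: "'a \<Rightarrow> nat"
  assumes G: "pair_graph G" and m: "m \<ge> 1" and img: "f ` pverts G = {1..m}"
    and E: "\<And>u v. u \<in> pverts G \<Longrightarrow> v \<in> pverts G \<Longrightarrow> (u, v) \<in> parcs G \<longleftrightarrow>
      (u \<noteq> v \<and> f u = f v \<and> t (f u)) \<or> f u = f v + 1 \<or> f v = f u + 1"
  shows "blow_up_of_path G"
proof -
  interpret pair_graph G by (fact G)
  \<comment> \<open>\<open>blow_up_of\<close> asks for natural numbers as vertices of the
    \<open>H i\<close>. So vertices are coded by \<open>g\<close>, \<open>H i\<close> is the coded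
    layer \<open>i\<close>, and the isomorphism sends a vertex to its layer number and its
    code.\<close>
  obtain g :: "'a \<Rightarrow> nat" where g: "inj_on g (pverts G)"
    using finite_imp_inj_to_nat_seg[OF pair_finite_verts] by blast
  define H where "H i = \<lparr> pverts = g ` {v \<in> pverts G. f v = i},
      parcs = {(a, b). a \<in> g ` {v \<in> pverts G. f v = i} \<and> b \<in> g ` {v \<in> pverts G. f v = i} \<and> a \<noteq> b \<and> t i} \<rparr>"
    for i
  define h where "h v = (f v, g v)" for v
  define F where "F = \<lparr> iso_verts = h, iso_arcs = map_prod h h,
    iso_head = snd, iso_tail = fst \<rparr>"
  have inj: "inj_on h (pverts G)"
    using g by (auto simp: h_def inj_on_def)
  have H_vert: "g u \<in> pverts (H i) \<longleftrightarrow> f u = i" if "u \<in> pverts G" for u i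
    using inj_onD[OF g] that by (auto simp: H_def)
  have H_arc: "(g u, g v) \<in> parcs (H i) \<longleftrightarrow> f u = i \<and> f v = i \<and> u \<noteq> v \<and> t i"
    if "u \<in> pverts G" "v \<in> pverts G" for u v i
  proof -
    have "g u = g v \<longleftrightarrow> u = v" using inj_onD[OF g] that by blast
    thus ?thesis using H_vert[OF that(1), of i] H_vert[OF that(2), of i] by (simp add: H_def)
  qed
  have fin: "finite (pverts (H i))" for i
    using pair_finite_verts by (simp add: H_def)
  have "complete_graph (H i) \<or> edgeless_graph (H i)" for i
  proof (cases "t i")
    case True
    hence "complete_graph (H i)"
      using fin[of i] unfolding complete_graph_def complete_digraph_pair_def by (auto simp: H_def)
    thus ?thesis ..
  next
    case False
    hence "edgeless_graph (H i)"
      using fin[of i] unfolding edgeless_graph_def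
      by (auto simp: H_def intro!: pair_graphI)
    thus ?thesis ..
  qed
  moreover have "pverts (H i) \<noteq> {}" if "i \<in> pverts (path_graph m)" for i
  proof -
    have "i \<in> f ` pverts G" using that img by (simp add: path_graph_def)
    thus ?thesis by (auto simp: H_def)
  qed
  moreover have "digraph_iso (with_proj G) (with_proj (graph_composition (path_graph m) H))"
    (is "digraph_iso _ (with_proj ?C)")
    unfolding digraph_iso_def
  proof (intro exI conjI)
    have "parcs G \<subseteq> pverts G \<times> pverts G"
      using in_arcsD1 in_arcsD2 by auto
    hence "inj_on (map_prod h h) (parcs G)"
      using inj_on_subset[OF map_prod_inj_on[OF inj inj]] by blast
    thus "pre_digraph.digraph_isomorphism (with_proj G) F"
      unfolding pre_digraph.digraph_isomorphism_def
      using inj wf_digraph_axioms by (simp add: F_def)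
    have verts: "h ` pverts G = pverts ?C"
    proof (intro equalityI subsetI)
      fix z assume "z \<in> h ` pverts G"
      thus "z \<in> pverts ?C" using img H_vert by (auto simp: h_def path_graph_def)
    next
      fix z assume "z \<in> pverts ?C"
      then obtain i a where "z = (i, a)" "a \<in> pverts (H i)" by auto
      thus "z \<in> h ` pverts G" by (auto simp: h_def H_def)
    qed
    have arcs_iff: "(h u, h v) \<in> parcs ?C \<longleftrightarrow> (u, v) \<in> parcs G"
      if "u \<in> pverts G" "v \<in> pverts G" for u v
    proof -
      have "f u \<in> {1..m}" "f v \<in> {1..m}" using that img by blast+
      hence "(h u, h v) \<in> parcs ?C \<longleftrightarrow>
          f u = f v \<and> u \<noteq> v \<and> t (f u) \<or> f u \<noteq> f v \<and> (f u = f v + 1 \<or> f v = f u + 1)"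
        unfolding h_def in_parcs_graph_composition H_vert[OF that(1)] H_vert[OF that(2)] H_arc[OF that]
        by (simp add: path_graph_def) metis
      thus ?thesis using E[OF that] by (cases "f u = f v") simp_all
    qed
    have "map_prod h h ` parcs G = parcs ?C"
    proof (intro equalityI subsetI)
      fix z assume "z \<in> map_prod h h ` parcs G"
      then obtain u v where "z = (h u, h v)" "(u, v) \<in> parcs G" by auto
      thus "z \<in> parcs ?C" using arcs_iff[of u v] in_arcsD1 in_arcsD2 by blast
    next
      fix z assume z: "z \<in> parcs ?C"
      hence "fst z \<in> pverts ?C" "snd z \<in> pverts ?C"
        by (auto simp: graph_composition_def Let_def)
      then obtain u v where "fst z = h u" "snd z = h v" and uv: "u \<in> pverts G" "v \<in> pverts G"
        unfolding verts[symmetric] by blast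
      hence "z = (h u, h v)" by (simp add: prod_eq_iff)
      moreover from this have "(u, v) \<in> parcs G" using z arcs_iff[OF uv] by simp
      ultimately show "z \<in> map_prod h h ` parcs G" by (metis map_prod_imageI)
    qed
    with verts show "with_proj ?C = app_iso F (with_proj G)"
      by (simp add: app_iso_def F_def with_proj_def)
  qed
  ultimately have "blow_up_of G (path_graph m)"
    unfolding blow_up_of_def by (intro exI[of _ H]) simp
  thus ?thesis using m unfolding blow_up_of_path_def by blast
qed

section \<open>Permutation graphs as pairs of linear orders\<close>

locale two_orders =
  fixes V :: "'a set" and pos val :: "'a \<Rightarrow> nat"
  assumes finite_V: "finite V" and inj_pos: "inj_on pos V" and inj_val: "inj_on val V"
begin

text \<open>Edges are the pairs on which the two orders disagree. \<open>T\<close> orients the edges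
  and \<open>P\<close> the non-edges, both along \<open>pos\<close>, and each is a strict partial
  order.\<close>

definition T :: "'a \<Rightarrow> 'a \<Rightarrow> bool" where
  "T u v \<longleftrightarrow> u \<in> V \<and> v \<in> V \<and> pos u < pos v \<and> val v < val u"

definition P :: "'a \<Rightarrow> 'a \<Rightarrow> bool" where
  "P u v \<longleftrightarrow> u \<in> V \<and> v \<in> V \<and> pos u < pos v \<and> val u < val v"

definition adj :: "'a \<Rightarrow> 'a \<Rightarrow> bool" where
  "adj u v \<longleftrightarrow> T u v \<or> T v u"

definition nbrs :: "'a \<Rightarrow> 'a set" where
  "nbrs u = {v. adj u v}"

lemma adj_sym: "adj u v \<Longrightarrow> adj v u"
  by (auto simp: adj_def)

lemma adj_commute: "adj u v \<longleftrightarrow> adj v u"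
  by (auto simp: adj_def)

lemma adj_irrefl [simp]: "\<not> adj u u"
  by (simp add: adj_def T_def)

lemma adj_in_V: "adj u v \<Longrightarrow> u \<in> V" "adj u v \<Longrightarrow> v \<in> V"
  by (auto simp: adj_def T_def)

lemma T_trans: "T u v \<Longrightarrow> T v w \<Longrightarrow> T u w"
  by (auto simp: T_def)

lemma T_asym: "T u v \<Longrightarrow> \<not> T v u"
  by (auto simp: T_def)

lemma P_trans: "P u v \<Longrightarrow> P v w \<Longrightarrow> P u w"
  by (auto simp: P_def)

lemma P_asym: "P u v \<Longrightarrow> \<not> P v u"
  by (auto simp: P_def)

lemma P_not_adj: "P u v \<Longrightarrow> \<not> adj u v"
  by (auto simp: P_def T_def adj_def)

lemma P_total: "u \<in> V \<Longrightarrow> v \<in> V \<Longrightarrow> u \<noteq> v \<Longrightarrow> \<not> adj u v \<Longrightarrow> P u v \<or> P v u"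
  using inj_pos inj_val unfolding adj_def T_def P_def inj_on_def by (metis linorder_neqE_nat)

section \<open>Forced orientations and forbidden configurations\<close>

text \<open>With the opposite direction, transitivity would make \<open>u\<close> and
  \<open>w\<close> adjacent. Hence two edges at a vertex whose other ends are not adjacent both
  enter it or both leave it.\<close>

lemma T_forced_in: "T u v \<Longrightarrow> adj v w \<Longrightarrow> \<not> adj u w \<Longrightarrow> T w v"
  unfolding adj_def using T_trans by blast

lemma T_forced_out: "T u v \<Longrightarrow> adj u w \<Longrightarrow> \<not> adj v w \<Longrightarrow> T u w"
  unfolding adj_def using T_trans by blast

text \<open>The alternative \<open>P v w\<close> would compose with \<open>P u v\<close> to
  \<open>P u w\<close>, against the edge \<open>uw\<close>. So an edge from \<open>u\<close> to a
  vertex not adjacent to \<open>v\<close> stays on one side of \<open>v\<close>.\<close>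

lemma P_forced_left: "P u v \<Longrightarrow> adj u w \<Longrightarrow> \<not> adj v w \<Longrightarrow> v \<noteq> w \<Longrightarrow> P w v"
  using P_total[of w v] P_trans P_not_adj adj_sym adj_in_V P_def by metis

lemma P_forced_right: "P u v \<Longrightarrow> adj v w \<Longrightarrow> \<not> adj u w \<Longrightarrow> u \<noteq> w \<Longrightarrow> P u w"
  using P_total[of w u] P_trans P_not_adj adj_sym adj_in_V P_def by metis

text \<open>Around an induced cycle, sources and sinks of \<open>T\<close> must alternate, which an
  odd length forbids.\<close>

lemma no_induced_C5:
  assumes "adj a b" "adj b c" "adj c d" "adj d e" "adj e a"
    and "\<not> adj a c" "\<not> adj b d" "\<not> adj c e" "\<not> adj d a" "\<not> adj e b"
  shows False
proof -
  have *: False if "T a b"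
    using that assms T_forced_in[of a b c] T_forced_out[of c b d] T_forced_in[of c d e]
      T_forced_out[of e d a] T_forced_in[of e a b] T_asym adj_commute by metis
  have False if "T b a"
    using that assms T_forced_out[of b a c] T_forced_in[of b c d] T_forced_out[of d c e]
      T_forced_in[of d e a] T_forced_out[of a e b] T_asym adj_commute by metis
  with * assms(1) show False unfolding adj_def by blast
qed

text \<open>At each triangle vertex, the edge to its private neighbour forces both triangle edges to
  enter or both to leave, in agreement with it. Sources and sinks would then alternate around a
  triangle.\<close>

lemma no_private_neighbours_of_triangle:
  assumes "adj d e1" "adj d e2" "adj e1 e2" "adj d c" "adj e1 f1" "adj e2 f2"
    and "\<not> adj c e1" "\<not> adj c e2" "\<not> adj f1 d" "\<not> adj f1 e2" "\<not> adj f2 d" "\<not> adj f2 e1"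
  shows False
proof -
  have *: False if "T c d"
  proof -
    have "T e1 d" "T e2 d" using that assms T_forced_in by blast+
    hence "T e1 f1" "T e2 f2" using assms T_forced_out adj_commute by metis+
    hence "T e1 e2" "T e2 e1" using assms T_forced_out adj_commute by metis+
    thus False using T_asym by blast
  qed
  have False if "T d c"
  proof -
    have "T d e1" "T d e2" using that assms T_forced_out by blast+
    hence "T f1 e1" "T f2 e2" using assms T_forced_in adj_commute by metis+
    hence "T e2 e1" "T e1 e2" using assms T_forced_in adj_commute by metis+
    thus False using T_asym by blast
  qed
  with * assms(4) show False unfolding adj_def by blast
qed

text \<open>The leaves form a \<open>P\<close>-chain; the private neighbour of the middle one would have to lie on both
  sides of the centre.\<close>

lemma no_private_neighbours_of_claw:
  assumes "adj d x" "adj d y" "adj d z" "adj x x'" "adj y y'" "adj z z'"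
    and "\<not> adj x y" "\<not> adj y z" "\<not> adj x z" "x \<noteq> y" "y \<noteq> z" "x \<noteq> z"
    and "\<not> adj x' d" "\<not> adj y' d" "\<not> adj z' d"
    and "\<not> adj x' y" "\<not> adj x' z" "\<not> adj y' x" "\<not> adj y' z" "\<not> adj z' x" "\<not> adj z' y"
  shows False
proof -
  have *: "\<not> (P a b \<and> P b c)"
    if "adj d a" "adj d b" "adj d c" "adj b b'" "\<not> adj b' a" "\<not> adj b' c" "\<not> adj b' d" for a b c b'
  proof
    assume P: "P a b \<and> P b c"
    have "b' \<noteq> a" "b' \<noteq> c" "b' \<noteq> d"
      using that P P_not_adj adj_sym by blast+
    have "P a b'" using P_forced_right[of a b b'] P that \<open>b' \<noteq> a\<close> adj_commute by blast
    hence left: "P d b'" using P_forced_left[of a b' d] that \<open>b' \<noteq> d\<close> adj_commute by blast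
    have "P b' c" using P_forced_left[of b c b'] P that \<open>b' \<noteq> c\<close> adj_commute by blast
    hence "P b' d" using P_forced_right[of b' c d] that \<open>b' \<noteq> d\<close> adj_commute by blast
    with left show False using P_asym by blast
  qed
  \<comment> \<open>However the three pairs of leaves are oriented, there is a directed path through
    all three; the six instances below are its possible forms.\<close>
  have "P x y \<or> P y x" "P y z \<or> P z y" "P x z \<or> P z x"
    using assms P_total adj_in_V by metis+
  thus False
    using *[of x y z y'] *[of z y x y'] *[of y x z x'] *[of z x y x'] *[of x z y z'] *[of y z x z'] assms
    by blast
qed

end

section \<open>Peeling off layers\<close>

text \<open>Connectedness is phrased by sets closed under neighbours, since this is how the peeling
  uses it: a stage that no edge leaves is the whole graph.\<close>

locale cubic_two_orders = two_orders +
  assumes cubic: "v \<in> V \<Longrightarrow> card (nbrs v) = 3"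
    and nonempty: "V \<noteq> {}"
    and connected: "U \<subseteq> V \<Longrightarrow> U \<noteq> {} \<Longrightarrow> (\<And>u. u \<in> U \<Longrightarrow> nbrs u \<subseteq> U) \<Longrightarrow> U = V"
begin

lemma nbrs_iff: "w \<in> nbrs u \<longleftrightarrow> adj u w"
  by (simp add: nbrs_def)

lemma third_neighbour:
  assumes "adj v a" "adj v b" "a \<noteq> b"
  obtains c where "nbrs v = {a, b, c}" "c \<noteq> a" "c \<noteq> b"
proof -
  have "card (nbrs v) = 3"
    using cubic assms adj_in_V by blast
  then obtain x y z where "nbrs v = {x, y, z}" "x \<noteq> y" "y \<noteq> z" "x \<noteq> z"
    by (auto simp: card_3_iff)
  moreover from this have "a \<in> {x, y, z}" "b \<in> {x, y, z}"
    using assms(1,2) by (auto simp: nbrs_def)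
  ultimately show thesis
    using that[of x] that[of y] that[of z] assms(3) by (elim insertE emptyE) (simp_all add: insert_commute)
qed

lemma other_neighbours:
  assumes "adj v a"
  obtains b c where "nbrs v = {a, b, c}" "b \<noteq> a" "c \<noteq> a" "c \<noteq> b"
proof -
  have "card (nbrs v) = 3"
    using cubic assms adj_in_V by blast
  hence "\<not> nbrs v \<subseteq> {a}"
    using card_mono[of "{a}" "nbrs v"] by auto
  then obtain b where "adj v b" "b \<noteq> a"
    by (auto simp: nbrs_def)
  with assms show thesis
    using third_neighbour[of v a b] that by metis
qed

lemma homogeneous_pair: "homogeneous adj {a, b}"
  using adj_sym by (auto simp: homogeneous_def)

lemma homogeneous_singleton: "homogeneous adj {a}"
  by (simp add: homogeneous_def)

section \<open>Extension across a single leaving edge\<close>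

text \<open>The invariant of the peeling: \<open>U\<close> is completely layered, its last layer is
  the single vertex \<open>c\<close>, and \<open>cd\<close> is the only edge leaving
  \<open>U\<close>.\<close>

definition pendant :: "'a set \<Rightarrow> 'a \<Rightarrow> 'a \<Rightarrow> bool" where
  "pendant U c d \<longleftrightarrow> path_layered adj U {c} \<and> U \<subseteq> V \<and> c \<in> U \<and> d \<notin> U \<and>
     nbrs c - U = {d} \<and> (\<forall>u \<in> U - {c}. nbrs u \<subseteq> U)"

text \<open>If \<open>d\<close> is in \<open>U\<close>, then \<open>U\<close> is closed under
  neighbours and connectedness makes it everything; otherwise \<open>cd\<close> is the single
  leaving edge.\<close>

lemma layered_or_pendant:
  assumes "path_layered adj U {c}" "U \<subseteq> V" "c \<in> U"
    and inner: "\<And>u. u \<in> U \<Longrightarrow> u \<noteq> c \<Longrightarrow> nbrs u \<subseteq> U"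
    and c: "nbrs c = {a, b, d}" "a \<in> U" "b \<in> U"
  shows "path_layered adj V {c} \<or> pendant U c d"
proof (cases "d \<in> U")
  case True
  hence "nbrs u \<subseteq> U" if "u \<in> U" for u
    using inner[OF that] c by (cases "u = c") auto
  hence "U = V"
    using connected[of U] assms(2,3) by blast
  with assms(1) show ?thesis by simp
next
  case False
  thus ?thesis using assms unfolding pendant_def by auto
qed

text \<open>The next layers are \<open>d\<close> and the pair of its other neighbours
  \<open>e1\<close>, \<open>e2\<close>. If these are adjacent, a single vertex \<open>f\<close>
  follows. If not, a pair \<open>f1\<close>, \<open>f2\<close> follows, which either ends the graph
  or is followed by a single vertex \<open>g\<close>.\<close>

lemma pendant_step:
  assumes "pendant U c d"
  shows "(\<exists>L. path_layered adj V L) \<or> (\<exists>U' c' d'. U \<subset> U' \<and> pendant U' c' d')"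
proof -
  have lay: "path_layered adj U {c}" and U: "U \<subseteq> V" "c \<in> U" "d \<notin> U"
    and nc: "nbrs c - U = {d}" and inner: "\<And>u. u \<in> U \<Longrightarrow> u \<noteq> c \<Longrightarrow> nbrs u \<subseteq> U"
    using assms unfolding pendant_def by blast+
  have out: "\<not> adj u w" "\<not> adj w u" if "u \<in> U" "w \<notin> U" "w \<noteq> d" for u w
    using that inner[of u] nc nbrs_iff[of w u] adj_commute[of u w] by blast+
  have cd: "adj c d" using nc nbrs_iff by blast
  have dU: "adj u d \<longleftrightarrow> u = c" if "u \<in> U" for u
    using that inner[of u] cd U nbrs_iff[of d u] by blast
  have lay_d: "path_layered adj (U \<union> {d}) {d}"
    by (rule path_layered.extend[OF lay])
      (use U dU in \<open>auto simp: homogeneous_singleton\<close>)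
  have dV: "d \<in> V" using cd adj_in_V by blast
  obtain e1 e2 where nd: "nbrs d = {c, e1, e2}" "e1 \<noteq> c" "e2 \<noteq> c" "e2 \<noteq> e1"
    using other_neighbours[OF adj_sym[OF cd]] by blast
  have e: "adj d e1" "adj d e2" using nd nbrs_iff by blast+
  have eU: "e1 \<notin> U" "e2 \<notin> U" using e nd dU adj_sym by blast+
  have ed: "e1 \<noteq> d" "e2 \<noteq> d" using e by auto
  have eV: "e1 \<in> V" "e2 \<in> V" using e adj_in_V by blast+
  have adj_d: "adj d w \<longleftrightarrow> w = c \<or> w = e1 \<or> w = e2" for w
    using nd nbrs_iff[of w d] by blast
  have lay_e: "path_layered adj (U \<union> {d} \<union> {e1, e2}) {e1, e2}"
    by (rule path_layered.extend[OF lay_d])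
      (use U eU ed nd out adj_d in \<open>auto simp: homogeneous_pair\<close>)
  show ?thesis
  proof (cases "adj e1 e2")
    case True
    obtain f where n1: "nbrs e1 = {d, e2, f}" and f: "f \<noteq> d" "f \<noteq> e2"
      using third_neighbour[of e1 d e2] e True ed adj_sym by metis
    obtain f' where n2: "nbrs e2 = {d, e1, f'}" and f': "f' \<noteq> d" "f' \<noteq> e1"
      using third_neighbour[of e2 d e1] e True ed adj_sym by metis
    have adj1: "adj e1 w \<longleftrightarrow> w = d \<or> w = e2 \<or> w = f" and adj2: "adj e2 w \<longleftrightarrow> w = d \<or> w = e1 \<or> w = f'" for w
      using n1 n2 nbrs_iff by blast+
    have ff: "f \<noteq> e1" "f' \<noteq> e2" "f \<notin> U" "f' \<notin> U"
      using adj1 adj2 out eU ed by (metis adj_irrefl)+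
    \<comment> \<open>Otherwise the triangle \<open>d\<close>, \<open>e1\<close>, \<open>e2\<close>
      has private neighbours \<open>c\<close>, \<open>f\<close>, \<open>f'\<close>.\<close>
    have "f = f'"
    proof (rule ccontr)
      assume "f \<noteq> f'"
      with no_private_neighbours_of_triangle[of d e1 e2 c f f'] show False
        using e True cd adj1 adj2 f f' ff adj_d U out eU ed adj_commute by metis
    qed
    obtain g where nf: "nbrs f = {e1, e2, g}"
      using third_neighbour[of f e1 e2] adj1 adj2 \<open>f = f'\<close> nd(4) adj_sym by metis
    have fV: "f \<in> V" using adj1 adj_in_V by blast
    let ?U = "U \<union> {d} \<union> {e1, e2} \<union> {f}"
    have lay_f: "path_layered adj ?U {f}"
      by (rule path_layered.extend[OF lay_e])
        (use f f' ff ed out adj_d adj1 adj2 \<open>f = f'\<close> U in \<open>auto simp: homogeneous_singleton\<close>)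
    have sub: "nbrs u \<subseteq> ?U" if "u \<in> ?U" "u \<noteq> f" for u
      using that inner[of u] nc nd n1 n2 U \<open>f = f'\<close> by (cases "u = c") auto
    have "path_layered adj V {f} \<or> pendant ?U f g"
      by (rule layered_or_pendant[OF lay_f _ _ sub nf]) (use U dV eV fV in auto)
    moreover have "U \<subset> ?U" using U by auto
    ultimately show ?thesis by blast
  next
    case False
    \<comment> \<open>Both sets have three elements, so if they differ, each has a vertex,
      \<open>a\<close> or \<open>b\<close>, missing from the other. The claw at \<open>d\<close>
      with leaves \<open>c\<close>, \<open>e1\<close>, \<open>e2\<close> then has private neighbours
      \<open>c'\<close>, \<open>a\<close>, \<open>b\<close>, where \<open>c'\<close> is a neighbour
      of \<open>c\<close> inside \<open>U\<close>.\<close>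
    have same: "nbrs e1 = nbrs e2"
    proof (rule ccontr)
      assume ne: "nbrs e1 \<noteq> nbrs e2"
      have card: "card (nbrs e1) = 3" "card (nbrs e2) = 3" using cubic eV by auto
      hence "finite (nbrs e1)" "finite (nbrs e2)" by (auto intro: card_ge_0_finite)
      hence "\<not> nbrs e1 \<subseteq> nbrs e2" "\<not> nbrs e2 \<subseteq> nbrs e1"
        using ne card card_subset_eq by metis+
      then obtain a b where ab: "adj e1 a" "\<not> adj e2 a" "adj e2 b" "\<not> adj e1 b"
        by (auto simp: nbrs_def)
      obtain c' where c': "adj c c'" "c' \<noteq> d"
        using other_neighbours[OF cd] nbrs_iff by (metis insertCI)
      have c'U: "c' \<in> U" "c' \<noteq> c" using c' nc nbrs_iff by auto
      have ad: "a \<noteq> d" "b \<noteq> d" using ab e adj_sym by blast+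
      have abU: "a \<notin> U" "b \<notin> U" using ab out eU ed by blast+
      have "\<not> adj a d" "\<not> adj b d"
        using ab abU U adj_d False adj_commute adj_irrefl by metis+
      with no_private_neighbours_of_claw[of d c e1 e2 c' a b] show False
        using cd e c' ab nd(2-4) False out[OF c'U(1)] dU[OF c'U(1)] c'U(2) out[OF U(2)] eU ed ad abU adj_commute
        by metis
    qed
    obtain f1 f2 where n1: "nbrs e1 = {d, f1, f2}" and f: "f1 \<noteq> d" "f2 \<noteq> d" "f2 \<noteq> f1"
      using other_neighbours[OF adj_sym[OF e(1)]] by blast
    have adj1: "adj e1 w \<longleftrightarrow> w = d \<or> w = f1 \<or> w = f2" and adj2: "adj e2 w \<longleftrightarrow> w = d \<or> w = f1 \<or> w = f2" for w
      using n1 same nbrs_iff by blast+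
    have fe: "f1 \<noteq> e1" "f1 \<noteq> e2" "f2 \<noteq> e1" "f2 \<noteq> e2"
      using adj1 adj2 adj_irrefl by metis+
    have fU: "f1 \<notin> U" "f2 \<notin> U" using adj1 out eU ed by metis+
    have fd: "\<not> adj d f1" "\<not> adj d f2" using adj_d fU U fe by auto
    have fV: "f1 \<in> V" "f2 \<in> V" using adj1 adj_in_V by blast+
    let ?W = "U \<union> {d} \<union> {e1, e2} \<union> {f1, f2}"
    have lay_f: "path_layered adj ?W {f1, f2}"
      by (rule path_layered.extend[OF lay_e])
        (use f fe fU ed out fd adj1 adj2 U in \<open>auto simp: homogeneous_pair\<close>)
    have subW: "nbrs u \<subseteq> ?W" if "u \<in> ?W" "u \<noteq> f1" "u \<noteq> f2" for u
      using that inner[of u] nc nd n1 same U by (cases "u = c") auto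
    have ef: "adj f1 e1" "adj f1 e2" "adj f2 e1" "adj f2 e2" using adj1 adj2 adj_sym by blast+
    obtain g where m1: "nbrs f1 = {e1, e2, g}" and g: "g \<noteq> e1" "g \<noteq> e2"
      using third_neighbour[of f1 e1 e2] ef nd(4) by metis
    obtain g' where m2: "nbrs f2 = {e1, e2, g'}" and g': "g' \<noteq> e1" "g' \<noteq> e2"
      using third_neighbour[of f2 e1 e2] ef nd(4) by metis
    have adjf1: "adj f1 w \<longleftrightarrow> w = e1 \<or> w = e2 \<or> w = g" and adjf2: "adj f2 w \<longleftrightarrow> w = e1 \<or> w = e2 \<or> w = g'" for w
      using m1 m2 nbrs_iff by blast+
    show ?thesis
    proof (cases "adj f1 f2")
      case True
      \<comment> \<open>The third neighbours of \<open>f1\<close> and \<open>f2\<close> are each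
        other, so no edge leaves \<open>?W\<close>.\<close>
      hence "g = f2" "g' = f1" using adjf1 adjf2 fe adj_commute by metis+
      hence closed: "nbrs u \<subseteq> ?W" if "u \<in> ?W" for u
        using subW[OF that] m1 m2 by auto
      have "?W = V"
        by (rule connected[OF _ _ closed]) (use U dV eV fV in auto)
      with lay_f show ?thesis by auto
    next
      case nadj: False
      have gU: "g \<notin> U" "g' \<notin> U" "g \<noteq> d" "g' \<noteq> d"
        using adjf1 adjf2 out fU f fd adj_commute by metis+
      have gf: "g \<noteq> f1" "g \<noteq> f2" "g' \<noteq> f1" "g' \<noteq> f2"
        using adjf1 adjf2 nadj adj_irrefl adj_commute by metis+
      \<comment> \<open>Now the claw is centred at \<open>e1\<close> with leaves \<open>d\<close>,
        \<open>f1\<close>, \<open>f2\<close>, and \<open>c\<close> is the private neighbour of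
        \<open>d\<close>.\<close>
      have "g = g'"
      proof (rule ccontr)
        assume "g \<noteq> g'"
        have "\<not> adj e1 c" "\<not> adj f1 c" "\<not> adj f2 c"
          using out[OF U(2)] eU ed fU f by blast+
        moreover have "\<not> adj e1 g" "\<not> adj e1 g'" "\<not> adj d g" "\<not> adj d g'"
          using adj1 adj_d g g' gf gU U(2) by auto
        moreover have "\<not> adj f2 g" "\<not> adj f1 g'" "adj f1 g" "adj f2 g'"
          using adjf1 adjf2 g g' \<open>g \<noteq> g'\<close> by auto
        moreover have "adj e1 d" "adj e1 f1" "adj e1 f2" "adj d c"
          using adj1 adj_d by auto
        ultimately show False
          using no_private_neighbours_of_claw[of e1 d f1 f2 c g g'] fd nadj f adj_sym by metis
      qed
      obtain h where ng: "nbrs g = {f1, f2, h}"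
        using third_neighbour[of g f1 f2] adjf1 adjf2 \<open>g = g'\<close> f(3) adj_sym by metis
      have gV: "g \<in> V" using adjf1 adj_in_V by blast
      have lay_g: "path_layered adj (?W \<union> {g}) {g}"
        by (rule path_layered.extend[OF lay_f])
          (use f fe g gf gU ed out adj_d adj1 adj2 adjf1 adjf2 \<open>g = g'\<close> U in \<open>auto simp: homogeneous_singleton\<close>)
      have sub: "nbrs u \<subseteq> ?W \<union> {g}" if "u \<in> ?W \<union> {g}" "u \<noteq> g" for u
        using that subW[of u] m1 m2 \<open>g = g'\<close> by blast
      have "path_layered adj V {g} \<or> pendant (?W \<union> {g}) g h"
        by (rule layered_or_pendant[OF lay_g _ _ sub ng]) (use U dV eV fV gV in auto)
      moreover have "U \<subset> ?W \<union> {g}" using U by auto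
      ultimately show ?thesis by blast
    qed
  qed
qed

text \<open>Each step either finishes or strictly enlarges \<open>U\<close> inside the finite set
  \<open>V\<close>.\<close>

lemma pendant_path_layered: "pendant U c d \<Longrightarrow> \<exists>L. path_layered adj V L"
proof (induction "card (V - U)" arbitrary: U c d rule: less_induct)
  case less
  have "card (V - U') < card (V - U)" if "U \<subset> U'" "pendant U' c' d'" for U' c' d'
  proof (rule psubset_card_mono)
    show "V - U' \<subset> V - U" using that by (auto simp: pendant_def)
  qed (simp add: finite_V)
  with less pendant_step[OF less.prems] show ?case by blast
qed

section \<open>Starting the layering at one end\<close>

text \<open>\<open>y\<close> and \<open>w\<close> are adjacent twins, both joined to
  \<open>x\<close> and \<open>s\<close>; minimality of \<open>x\<close> and \<open>y\<close> forces
  the last neighbours of \<open>x\<close> and \<open>s\<close> to coincide, giving layers of sizes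
  2, 2, 1. The minimality assumptions involve only \<open>adj\<close> and \<open>P\<close>, so
  \<open>x\<close> and \<open>y\<close> may be exchanged in applications.\<close>

lemma diamond_end:
  assumes minx: "\<And>v. v \<in> V \<Longrightarrow> v \<noteq> x \<Longrightarrow> adj x v \<or> P x v"
    and miny: "\<And>v. v \<in> V \<Longrightarrow> v \<noteq> y \<Longrightarrow> adj y v \<or> P y v"
    and nx: "nbrs x = {y, w, q}" and ny: "nbrs y = {x, w, s}" and nw: "nbrs w = {x, y, s}"
    and qs: "q \<noteq> s" "q \<noteq> y" "q \<noteq> w" "s \<noteq> x"
  shows "\<exists>L. path_layered adj V L"
proof -
  have ax: "adj x v \<longleftrightarrow> v = y \<or> v = w \<or> v = q" for v
    using nx nbrs_iff[of v x] by simp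
  have ay: "adj y v \<longleftrightarrow> v = x \<or> v = w \<or> v = s" for v
    using ny nbrs_iff[of v y] by simp
  have aw: "adj w v \<longleftrightarrow> v = x \<or> v = y \<or> v = s" for v
    using nw nbrs_iff[of v w] by simp
  have d: "x \<noteq> y" "x \<noteq> w" "y \<noteq> w" "q \<noteq> x" "s \<noteq> y" "s \<noteq> w"
    using ax ay aw adj_irrefl by metis+
  have adj: "adj x y" "adj x w" "adj x q" "adj y s"
    by (simp_all add: ax ay)
  have V: "x \<in> V" "y \<in> V" "w \<in> V" "q \<in> V" "s \<in> V"
    by (rule adj_in_V[OF adj(1)] adj_in_V(2)[OF adj(2)] adj_in_V(2)[OF adj(3)] adj_in_V(2)[OF adj(4)])+
  obtain q' where ns: "nbrs s = {y, w, q'}" and q': "q' \<noteq> y" "q' \<noteq> w"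
    using third_neighbour[of s y w] ay aw d adj_sym by metis
  have as: "adj s v \<longleftrightarrow> v = y \<or> v = w \<or> v = q'" for v
    using ns nbrs_iff[of v s] by simp
  have q's: "q' \<noteq> s" "q' \<noteq> x" "q' \<in> V"
    using as ax d qs adj_irrefl adj_sym adj_in_V by metis+
  have "q = q'"
  proof (rule ccontr)
    assume ne: "q \<noteq> q'"
    have "P y q" using miny[of q] ay V d qs by blast
    \<comment> \<open>The edge \<open>ys\<close> carries \<open>P y q\<close> over to
      \<open>s\<close>, as \<open>s\<close> is not adjacent to \<open>q\<close>.\<close>
    hence "P s q" using P_forced_left[of y q s] ay as ne d qs adj_commute by metis
    show False
    proof (cases "adj q q'")
      case True
      \<comment> \<open>The vertices \<open>y\<close>, \<open>x\<close>, \<open>q\<close>,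
        \<open>q'\<close>, \<open>s\<close> form an induced five-cycle.\<close>
      thus False using no_induced_C5[of y x q q' s] ax ay as ne d qs q' q's adj_commute by metis
    next
      case False
      \<comment> \<open>The edge \<open>sq'\<close> carries \<open>P s q\<close> over to
        \<open>q'\<close>. With \<open>P x q'\<close>, which holds by minimality of
        \<open>x\<close>, this contradicts the edge \<open>xq\<close>.\<close>
      have "P q' q" using P_forced_left[of s q q'] \<open>P s q\<close> False as ne by blast
      moreover have "P x q'" using minx[of q'] ax q' q's ne by blast
      ultimately show False using P_trans P_not_adj ax by metis
    qed
  qed
  obtain h where nq: "nbrs q = {x, s, h}"
    using third_neighbour[of q x s] ax as \<open>q = q'\<close> qs adj_sym by metis
  have "path_layered adj {y, w} {y, w}"
    using ay by (intro path_layered.single) (auto simp: homogeneous_pair)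
  hence "path_layered adj ({y, w} \<union> {x, s}) {x, s}"
    by (rule path_layered.extend)
      (use ax ay aw as d qs q's in \<open>auto simp: homogeneous_pair\<close>)
  hence lay: "path_layered adj ({y, w} \<union> {x, s} \<union> {q}) {q}"
    by (rule path_layered.extend)
      (use ax ay aw as d qs \<open>q = q'\<close> in \<open>auto simp: homogeneous_singleton\<close>)
  have "path_layered adj V {q} \<or> pendant ({y, w} \<union> {x, s} \<union> {q}) q h"
    by (rule layered_or_pendant[OF lay _ _ _ nq]) (use V nx ny nw ns \<open>q = q'\<close> in auto)
  thus ?thesis using pendant_path_layered by blast
qed

lemma path_layered_V: "\<exists>L. path_layered adj V L"
proof -
  \<comment> \<open>\<open>x\<close> is first in the order \<open>pos\<close> and \<open>y\<close>
    in the order \<open>val\<close>. Under \<open>T\<close>, all edges at \<open>x\<close> leave it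
    and all edges at \<open>y\<close> enter it.\<close>
  obtain x where x: "x \<in> V" "\<And>v. v \<in> V \<Longrightarrow> pos x \<le> pos v"
    using finite_V nonempty by (metis arg_min_if_finite(1) arg_min_least)
  obtain y where y: "y \<in> V" "\<And>v. v \<in> V \<Longrightarrow> val y \<le> val v"
    using finite_V nonempty by (metis arg_min_if_finite(1) arg_min_least)
  have minx: "T x v \<or> P x v" if "v \<in> V" "v \<noteq> x" for v
    using that x inj_pos inj_val unfolding T_def P_def inj_on_def
    by (metis le_neq_implies_less linorder_neqE_nat)
  have miny: "T v y \<or> P y v" if "v \<in> V" "v \<noteq> y" for v
    using that y inj_pos inj_val unfolding T_def P_def inj_on_def
    by (metis le_neq_implies_less linorder_neqE_nat)
  have adjx: "adj x v \<or> P x v" if "v \<in> V" "v \<noteq> x" for v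
    using minx[OF that] by (auto simp: adj_def)
  have adjy: "adj y v \<or> P y v" if "v \<in> V" "v \<noteq> y" for v
    using miny[OF that] by (auto simp: adj_def)
  have outx: "T x v" if "adj x v" for v
    using minx[of v] that P_not_adj adj_in_V adj_irrefl by metis
  have iny: "T v y" if "adj y v" for v
    using miny[of v] that P_not_adj adj_in_V adj_irrefl by metis
  have "x \<noteq> y"
  proof
    assume "x = y"
    hence "nbrs x = {}" using outx iny T_asym by (auto simp: nbrs_def)
    thus False using cubic[OF x(1)] by simp
  qed
  hence xy: "adj x y"
    using minx[of y] miny[of x] x y P_asym by (auto simp: adj_def)
  show ?thesis
  proof (cases "\<exists>w. adj x w \<and> adj y w")
    case True
    then obtain w where w: "adj x w" "adj y w" by blast
    have wxy: "w \<noteq> x" "w \<noteq> y" using w by auto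
    obtain q where nx: "nbrs x = {y, w, q}" "q \<noteq> y" "q \<noteq> w"
      using third_neighbour[OF xy w(1)] wxy by metis
    obtain s where ny: "nbrs y = {x, w, s}" "s \<noteq> x" "s \<noteq> w"
      using third_neighbour[OF adj_sym[OF xy] w(2)] wxy by metis
    obtain t where nw: "nbrs w = {x, y, t}" "t \<noteq> x" "t \<noteq> y"
      using third_neighbour[of w x y] w adj_sym \<open>x \<noteq> y\<close> by metis
    have "adj w t" using nw nbrs_iff by blast
    \<comment> \<open>Here \<open>T x w\<close> and \<open>T w y\<close>. An edge from
      \<open>w\<close> to \<open>t\<close> extends the first, an edge from \<open>t\<close> to
      \<open>w\<close> the second.\<close>
    hence "adj x t \<or> adj y t"
      using T_forced_in[OF outx[OF w(1)], of t] T_forced_out[OF iny[OF w(2)], of t] T_asym by blast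
    hence t: "t = q \<or> t = s"
      using nx ny nw nbrs_iff[of t] \<open>adj w t\<close> by auto
    show ?thesis
    proof (cases "q = s")
      case True
      with t have "t = q" by simp
      have adjq: "adj q x" "adj q y" "adj q w"
        using nx ny nw True \<open>t = q\<close> nbrs_iff adj_sym by blast+
      then obtain z where "nbrs q = {x, y, z}" using third_neighbour[of q x y] \<open>x \<noteq> y\<close> by metis
      hence nq: "nbrs q = {x, y, w}" using adjq(3) wxy nbrs_iff[of w q] by auto
      \<comment> \<open>The four vertices form a complete graph, which is a single layer.\<close>
      let ?U = "{x, y, w, q}"
      have "homogeneous adj ?U"
        using nx ny nw True \<open>t = q\<close> nq unfolding homogeneous_def by (auto simp flip: nbrs_iff)
      moreover have "?U = V"
        using connected[of ?U] nx ny nw nq True \<open>t = q\<close> adjq w adj_in_V by auto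
      ultimately show ?thesis using path_layered.single[of adj ?U] by auto
    next
      case False
      show ?thesis
      proof (cases "t = s")
        case True
        show ?thesis
          by (rule diamond_end[OF adjx adjy nx(1) ny(1)]) (use nx ny nw True False in auto)
      next
        case nts: False
        \<comment> \<open>Now \<open>t = q\<close>, so \<open>w\<close> is a twin of
          \<open>x\<close> and the two ends exchange roles.\<close>
        show ?thesis
          by (rule diamond_end[OF adjy adjx ny(1) nx(1)]) (use nx ny nw t nts False in auto)
      qed
    qed
  next
    case False
    obtain p q where nx: "nbrs x = {y, p, q}" "p \<noteq> y" "q \<noteq> y" "q \<noteq> p"
      using other_neighbours[OF xy] by blast
    obtain r s where ny: "nbrs y = {x, r, s}" "r \<noteq> x" "s \<noteq> x" "s \<noteq> r"
      using other_neighbours[OF adj_sym[OF xy]] by blast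
    \<comment> \<open>If \<open>a\<close> and \<open>b\<close> were not adjacent, minimality gives
      \<open>P y a\<close> and \<open>P x b\<close>; then \<open>P a b\<close> contradicts the edge
      \<open>yb\<close>, and \<open>P b a\<close> the edge \<open>xa\<close>.\<close>
    have cross: "adj a b" if "adj x a" "a \<noteq> y" "adj y b" "b \<noteq> x" for a b
    proof (rule ccontr)
      assume "\<not> adj a b"
      moreover have "a \<noteq> b" "\<not> adj y a" "\<not> adj x b" using that False by blast+
      moreover have "P y a" "P x b" using that calculation adjx adjy adj_in_V by blast+
      ultimately show False using P_total[of a b] that P_trans P_not_adj adj_in_V by metis
    qed
    have a: "adj x p" "adj x q" "adj y r" "adj y s" using nx ny nbrs_iff by blast+
    have third: "nbrs u = {i, j, k}" if u: "adj u i" "adj u j" "adj u k" "i \<noteq> j" "k \<noteq> i" "k \<noteq> j" for u i j k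
    proof -
      obtain z where "nbrs u = {i, j, z}" using third_neighbour[OF u(1,2,4)] by metis
      thus ?thesis using u nbrs_iff[of k u] by auto
    qed
    have n: "nbrs p = {x, r, s}" "nbrs q = {x, r, s}" "nbrs r = {y, p, q}" "nbrs s = {y, p, q}"
      using a cross nx ny adj_sym by (intro third; metis)+
    have disj: "{y, p, q} \<inter> {x, r, s} = {}"
      using False a xy adj_irrefl adj_sym nx ny \<open>x \<noteq> y\<close> by auto
    \<comment> \<open>The two sides of the complete bipartite graph serve as the two layers.\<close>
    have "path_layered adj {x, r, s} {x, r, s}"
      using disj n nx by (intro path_layered.single) (auto simp: homogeneous_def simp flip: nbrs_iff)
    hence "path_layered adj ({x, r, s} \<union> {y, p, q}) {y, p, q}"
      by (rule path_layered.extend)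
        (use disj n nx ny in \<open>auto simp: homogeneous_def simp flip: nbrs_iff\<close>)
    moreover have "{x, r, s} \<union> {y, p, q} = V"
      by (rule connected) (use n nx ny a xy adj_in_V in auto)
    ultimately show ?thesis by auto
  qed
qed

end

section \<open>Translation from graphs to pairs of orders\<close>

theorem theorem4p5:
  fixes G :: "'a pair_pre_digraph"
  assumes "pair_graph G"
    and "connected (with_proj G)"
    and "regular_graph 3 G"
    and "permutation_graph G"
  shows "blow_up_of_path G"
proof -
  interpret pair_graph G by (fact assms(1))
  let ?V = "pverts G" and ?n = "card (pverts G)"
  obtain v \<pi> where v: "bij_betw v {1..?n} ?V" and \<pi>: "\<pi> permutes {1..?n}"
    and arc: "\<And>i j. i \<in> {1..?n} \<Longrightarrow> j \<in> {1..?n} \<Longrightarrow> i < j \<Longrightarrow> (v i, v j) \<in> parcs G \<longleftrightarrow> \<pi> i > \<pi> j"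
    using assms(4) unfolding permutation_graph_def Let_def by blast
  \<comment> \<open>\<open>pos\<close> is the index of a vertex in the labelling and
    \<open>val\<close> the image of that index under the permutation.\<close>
  define pos where "pos = inv_into {1..?n} v"
  define val where "val = \<pi> \<circ> pos"
  have pos: "bij_betw pos ?V {1..?n}"
    unfolding pos_def by (rule bij_betw_inv_into[OF v])
  have val: "bij_betw val ?V {1..?n}"
    unfolding val_def by (rule bij_betw_trans[OF pos permutes_imp_bij[OF \<pi>]])
  interpret two_orders ?V pos val
    using pos val by unfold_locales (auto simp: bij_betw_def)
  have sym: "(b, a) \<in> parcs G" if "(a, b) \<in> parcs G" for a b
    using that sym_arcs unfolding symmetric_def by (auto dest: symD)
  have less: "(a, b) \<in> parcs G \<longleftrightarrow> val b < val a" if "a \<in> ?V" "b \<in> ?V" "pos a < pos b" for a b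
  proof -
    have "v (pos a) = a" "v (pos b) = b"
      using that v by (auto simp: pos_def bij_betw_def intro!: f_inv_into_f)
    moreover have "pos a \<in> {1..?n}" "pos b \<in> {1..?n}"
      using that pos by (auto simp: bij_betw_def)
    ultimately show ?thesis using arc[of "pos a" "pos b"] that(3) by (simp add: val_def)
  qed
  have adj: "adj a b \<longleftrightarrow> (a, b) \<in> parcs G" for a b
  proof (cases "a \<in> ?V \<and> b \<in> ?V \<and> a \<noteq> b")
    case True
    hence "pos a < pos b \<or> pos b < pos a"
      using inj_onD[OF inj_pos, of a b] by (metis nat_neq_iff)
    thus ?thesis using True less[of a b] less[of b a] sym by (auto simp: adj_def T_def)
  next
    case False
    thus ?thesis using adj_in_V adj_irrefl in_arcsD1 in_arcsD2 no_loops'[of a b] by auto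
  qed
  interpret cubic_two_orders ?V pos val
  proof
    fix u assume "u \<in> ?V"
    hence "card (out_arcs (with_proj G) u) = 3"
      using assms(3) by (simp add: regular_graph_def out_degree_def)
    moreover have "out_arcs (with_proj G) u = Pair u ` nbrs u"
      by (auto simp: out_arcs_def nbrs_def adj)
    moreover have "card (Pair u ` nbrs u) = card (nbrs u)"
      by (rule card_image) (simp add: inj_on_def)
    ultimately show "card (nbrs u) = 3" by simp
  next
    show "?V \<noteq> {}"
      using assms(2) by (auto simp: connected_def strongly_connected_def mk_symmetric_def)
  next
    fix U assume U: "U \<subseteq> ?V" "U \<noteq> {}" and closed: "\<And>u. u \<in> U \<Longrightarrow> nbrs u \<subseteq> U"
    obtain u where u: "u \<in> U" using U by blast
    \<comment> \<open>A set closed under neighbours contains everything reachable from one of its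
      vertices.\<close>
    have "w \<in> U" if "w \<in> ?V" for w
    proof -
      have "u \<rightarrow>\<^sup>*\<^bsub>with_proj (mk_symmetric (with_proj G))\<^esub> w"
        using assms(2) u U that by (auto simp: connected_def strongly_connected_def mk_symmetric_def)
      thus ?thesis unfolding reachable_def
      proof (induction rule: rtrancl_on_induct)
        case base
        show ?case by (fact u)
      next
        case (step y z)
        hence "(y, z) \<in> parcs G" using sym by (auto simp: mk_symmetric_def)
        thus ?case using closed[OF step.IH] by (auto simp: nbrs_def adj)
      qed
    qed
    thus "U = ?V" using U by blast
  qed
  obtain L where "path_layered adj ?V L" using path_layered_V by blast
  then obtain f t and m :: nat where m: "m \<ge> 1" and f: "f ` ?V = {1..m}"
    and layers: "\<forall>u \<in> ?V. \<forall>v \<in> ?V. adj u v \<longleftrightarrow>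
      (u \<noteq> v \<and> f u = f v \<and> t (f u)) \<or> f u = f v + 1 \<or> f v = f u + 1"
    using path_layered_layer_function[of adj ?V L] adj_sym adj_irrefl by blast
  show ?thesis
    by (rule blow_up_of_pathI[OF assms(1) m f layers[unfolded adj, rule_format]])
qed

end
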